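(* Let $d\ge 2$ and let $g$ be a random Riemannian metric on $\mathbb{R}^d$ satisfying the standing assumptions listed in the context. For $v\in S^{d-1}$ let $\mu_v\ge 0$ be the non-random constant with $\lim_{t\to\infty}\tfrac1t d(0,tv)=\mu_v$ almost surely and in $L^1$. Then the constants $\mu_v$ are all positive: $\mu_v>0$ for every $v\in S^{d-1}$.
   Context: Setting. Let $d\ge2$, let $\mathrm{SPD}$ be the set of symmetric positive-definite $d\times d$ real matrices, let $\Omega=C(\mathbb{R}^d,\mathrm{SPD})$ with the $\sigma$-algebra generated by cylinder sets, and let $\mathbb{P}$ be a probability measure on $\Omega$; $g\in\Omega$ denotes the random Riemannian metric with law $\mathbb{P}$. Standing assumptions: (i) $\mathbb{P}$ is translation-invariant; (ii) $\mathbb{P}$ has finite-range dependence: there exists $R>0$ such that if $|x-y|\ge R$, then $g(x)$ and $g(y)$ are independent; (iii) with $C_0=[-1/2,1/2)^d$ and $\Lambda_0=\sup_{x\in C_0}(\text{maximum eigenvalue of }g(x))$, one has $\mathbb{E}[e^{r\Lambda_0}]<\infty$ for all $r\in\mathbb{R}$. Distance. For a $C^1$-curve $\gamma:[a,b]\to\mathbb{R}^d$, its Riemannian length is $R(\gamma)=\int_a^b\sqrt{\langle\dot\gamma(t),g(\gamma(t))\dot\gamma(t)\rangle}\,dt$; $d(x,y)=\inf_\gamma R(\gamma)$ over all $C^1$-curves $\gamma$ connecting $x$ to $y$. $|\cdot|$ is the Euclidean norm. The existence of the constants $\mu_v$ is given by Kingman's subadditive ergodic theorem.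
   Formalization: Finite-range dependence is taken for the field: g restricted to A and g restricted to B are independent whenever all points of A and B are at distance at least R; independence of g(x) and g(y) at single points alone does not make the limits μ_v non-random. *)

theory Defs
  imports "HOL-Probability.Probability"
begin

definition spd :: "real^'n^'n \<Rightarrow> bool" where
  "spd A \<longleftrightarrow> transpose A = A \<and> (\<forall>v. v \<noteq> 0 \<longrightarrow> 0 < v \<bullet> (A *v v))"

definition max_eigenvalue :: "real^'n^'n \<Rightarrow> real" where
  "max_eigenvalue A = Max {l. \<exists>v. v \<noteq> 0 \<and> A *v v = l *\<^sub>R v}"

definition metrics :: "(real^'n \<Rightarrow> real^'n^'n) set" where
  "metrics = {g. continuous_on UNIV g \<and> (\<forall>x. spd (g x))}"

definition cylinder_algebra :: "(real^'n \<Rightarrow> real^'n^'n) measure" where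
  "cylinder_algebra = sigma metrics
     {{g \<in> metrics. \<forall>x\<in>F. g x \<in> B x} | F B. finite F \<and> (\<forall>x. B x \<in> sets borel)}"

text \<open>Below, a law \<open>P\<close> on \<open>metrics\<close> is given, and the random metric is the canonical one,
  \<open>g \<mapsto> g\<close>.\<close>

definition translation_invariant :: "(real^'n \<Rightarrow> real^'n^'n) measure \<Rightarrow> bool" where
  "translation_invariant P \<longleftrightarrow> (\<forall>z. distr P P (\<lambda>g x. g (x + z)) = P)"

text \<open>Finite-range dependence is a property of the field: its restrictions to any two regions at
  Euclidean distance at least \<open>R\<close> are independent. Independence of the single matrices \<open>g x\<close> and
  \<open>g y\<close> whenever \<open>norm (x - y) \<ge> R\<close> is the case of singletons. That case alone does not imply
  ergodicity, hence not the existence of non-random \<open>\<mu>\<^sub>v\<close>: let \<open>h\<close> be positive, continuous, 1-periodic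
  and not constant, \<open>a\<close> uniform on \<open>[0, 1]\<close>, and \<open>b\<close> independent of \<open>a\<close> with a rotation-invariant
  density whose characteristic function vanishes outside a ball. Then \<open>h (a + b \<bullet> x)\<^sup>2\<close> times the
  identity is translation-invariant and independent at any two distant points, but the limit of
  \<open>d(0, tv) / t\<close> depends on the angle between \<open>b\<close> and \<open>v\<close>.\<close>

definition finite_range_dependence :: "(real^'n \<Rightarrow> real^'n^'n) measure \<Rightarrow> bool" where
  "finite_range_dependence P \<longleftrightarrow>
     (\<exists>R>0. \<forall>A B. (\<forall>x\<in>A. \<forall>y\<in>B. R \<le> norm (x - y)) \<longrightarrow>
        prob_space.indep_var P
          (\<Pi>\<^sub>M x\<in>A. borel) (\<lambda>g. restrict g A)
          (\<Pi>\<^sub>M y\<in>B. borel) (\<lambda>g. restrict g B))"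

definition unit_cube :: "(real^'n) set" where
  "unit_cube = {x. \<forall>i. - 1/2 \<le> x $ i \<and> x $ i < 1/2}"

text \<open>The supremum is over a bounded set for \<open>g \<in> metrics\<close>, as \<open>unit_cube\<close> has compact closure.\<close>

definition Lambda0 :: "(real^'n \<Rightarrow> real^'n^'n) \<Rightarrow> real" where
  "Lambda0 g = (SUP x\<in>unit_cube. max_eigenvalue (g x))"

definition exponential_moments :: "(real^'n \<Rightarrow> real^'n^'n) measure \<Rightarrow> bool" where
  "exponential_moments P \<longleftrightarrow> (\<forall>r::real. integrable P (\<lambda>g. exp (r * Lambda0 g)))"

text \<open>The library predicate \<open>C1_differentiable_on\<close> asks for two-sided derivatives at the end points;
  here they are one-sided, so that only the values of the curve on the interval matter.\<close>

definition C1_curve :: "real \<Rightarrow> real \<Rightarrow> (real \<Rightarrow> real^'n) \<Rightarrow> bool" where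
  "C1_curve a b \<gamma> \<longleftrightarrow> a < b \<and>
     (\<exists>D. continuous_on {a..b} D \<and>
          (\<forall>t\<in>{a..b}. (\<gamma> has_vector_derivative D t) (at t within {a..b})))"

definition riem_length ::
    "(real^'n \<Rightarrow> real^'n^'n) \<Rightarrow> real \<Rightarrow> real \<Rightarrow> (real \<Rightarrow> real^'n) \<Rightarrow> real" where
  "riem_length g a b \<gamma> = integral {a..b}
     (\<lambda>t. let w = vector_derivative \<gamma> (at t within {a..b}) in sqrt (w \<bullet> (g (\<gamma> t) *v w)))"

definition riem_dist ::
    "(real^'n \<Rightarrow> real^'n^'n) \<Rightarrow> real^'n \<Rightarrow> real^'n \<Rightarrow> real" where
  "riem_dist g x y =
     Inf {riem_length g a b \<gamma> | a b \<gamma>. C1_curve a b \<gamma> \<and> \<gamma> a = x \<and> \<gamma> b = y}"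

definition time_constant ::
    "(real^'n \<Rightarrow> real^'n^'n) measure \<Rightarrow> real^'n \<Rightarrow> real \<Rightarrow> bool" where
  "time_constant P v m \<longleftrightarrow> 0 \<le> m \<and>
     (AE g in P. ((\<lambda>t. riem_dist g 0 (t *\<^sub>R v) / t) \<longlongrightarrow> m) at_top) \<and>
     (\<forall>t>0. integrable P (\<lambda>g. riem_dist g 0 (t *\<^sub>R v) / t)) \<and>
     ((\<lambda>t. \<integral>g. \<bar>riem_dist g 0 (t *\<^sub>R v) / t - m\<bar> \<partial>P) \<longlongrightarrow> 0) at_top"

end

theory Submission
  imports Defs
begin

text \<open>
  The idea is a Peierls argument at a fixed scale. By continuity and positive definiteness, a metric
  is bounded below on every ball by some \<open>\<delta>\<^sup>2 > 0\<close> times the Euclidean one. Hence for small \<open>\<delta>\<close> it is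
  very unlikely that the metric fails this bound somewhere in a given ball of fixed radius; call such
  a ball degenerate. A curve that leaves a ball which is not degenerate has to pay a fixed amount of
  length, so a short curve over a long distance must meet many degenerate balls.

  To count them, a curve from \<open>0\<close> to a point at distance \<open>N\<rho>\<close> is cut at \<open>N\<close> successive times of
  last exit from a ball of radius \<open>\<rho>\<close> (\<open>last_exit_chain\<close>). Since the curve never comes back
  to a ball after its last exit, all the points found in this way are \<open>\<rho>\<close>-separated, while
  consecutive ones are at distance exactly \<open>\<rho>\<close>. Rounded to \<open>\<int>\<^sup>d\<close>, they form a lattice path with
  bounded steps, and there are only exponentially many of these (\<open>card_paths\<close>). The separation, with
  \<open>\<rho>\<close> large compared with the range of dependence, makes the balls around the points of the path
  independent, without any selection of a sparse subset, and it excludes that one degenerate ball is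
  counted twice.

  If the curve is shorter than \<open>\<delta>N/2\<close>, at least half of the \<open>N\<close> balls are degenerate. With \<open>N = 2m\<close>
  and \<open>K\<close> possible steps there are at most \<open>K\<^sup>2\<^sup>m\<close> paths and \<open>4\<^sup>m\<close> choices of \<open>m\<close> points on each,
  so this has probability at most \<open>(4K\<^sup>2p)\<^sup>m\<close>, where \<open>p\<close> is the probability that a ball is degenerate
  (\<open>prob_all_degenerate\<close>). A small \<open>\<delta>\<close> makes this at most \<open>1/2\<close>
  (\<open>linear_lower_bound_with_probability_half\<close>). A linear lower bound that holds with probability at
  least \<open>1/2\<close> along a sequence of distances tending to infinity is incompatible with convergence of
  \<open>d(0, tv) / t\<close> to \<open>0\<close> in \<open>L\<^sup>1\<close>.
\<close>

section \<open>Chains of separated points along a curve\<close>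

text \<open>The weight \<open>f\<close> stands for the speed of the curve and \<open>G\<close> for the centres whose surroundings are
  expensive to leave. The next point is the \<^emph>\<open>last\<close> one at distance \<open>\<rho>\<close> from the current one: the
  rest of the curve then stays outside the open ball, which separates the current point from all
  later ones and not only from the next. The triangle inequality guarantees \<open>N\<close> such steps.\<close>

lemma last_exit_chain:
  fixes \<gamma> :: "real \<Rightarrow> 'a::metric_space"
  assumes cont: "continuous_on {a..b} \<gamma>" and f: "f integrable_on {a..b}"
    and \<rho>: "\<rho> > 0"
    and cost: "\<And>s u. a \<le> s \<Longrightarrow> s \<le> u \<Longrightarrow> u \<le> b \<Longrightarrow> dist (\<gamma> s) (\<gamma> u) = \<rho>
      \<Longrightarrow> of_bool (G (\<gamma> s)) * \<delta> \<le> integral {s..u} (f::real\<Rightarrow>real)"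
    and pos: "\<And>t. t \<in> {a..b} \<Longrightarrow> 0 \<le> f t"
  shows "a \<le> s \<Longrightarrow> s \<le> b \<Longrightarrow> real N * \<rho> \<le> dist (\<gamma> s) (\<gamma> b) \<Longrightarrow>
    \<exists>xs. length xs = N \<and> (xs \<noteq> [] \<longrightarrow> hd xs = \<gamma> s) \<and> set xs \<subseteq> \<gamma> ` {s..b}
      \<and> sorted_wrt (\<lambda>x y. \<rho> \<le> dist x y) xs \<and> successively (\<lambda>x y. dist x y \<le> \<rho>) xs
      \<and> \<delta> * real (length (filter G xs)) \<le> integral {s..b} f"
proof (induction N arbitrary: s)
  case 0
  have "0 \<le> integral {s..b} f"
    using 0 f pos by (intro integral_nonneg integrable_subinterval_real[OF f]) auto
  then show ?case by (intro exI[of _ "[]"]) auto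
next
  case (Suc N)
  have cs: "continuous_on {s..b} (\<lambda>t. dist (\<gamma> s) (\<gamma> t))"
    using Suc.prems by (intro continuous_intros continuous_on_subset[OF cont]) auto
  define K where "K = {t \<in> {s..b}. dist (\<gamma> s) (\<gamma> t) \<le> \<rho>}"
  have "K = {s..b} \<inter> (\<lambda>t. dist (\<gamma> s) (\<gamma> t)) -` {..\<rho>}" by (auto simp: K_def)
  then have "closed K" using cs by (simp add: continuous_closed_preimage)
  moreover have "bounded K" unfolding K_def by (rule bounded_subset[of "{s..b}"]) auto
  ultimately have "compact K" by (simp add: compact_eq_bounded_closed)
  moreover have "s \<in> K" using Suc.prems \<rho> by (simp add: K_def)
  ultimately obtain s' where s': "s' \<in> K" "\<And>t. t \<in> K \<Longrightarrow> t \<le> s'"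
    using compact_attains_sup[of K] by auto
  have "0 \<le> real N * \<rho>" using \<rho> by simp
  then have far: "\<rho> \<le> dist (\<gamma> s) (\<gamma> b)"
    using Suc.prems(3) by (simp add: algebra_simps)
  \<comment> \<open>After the last time in the closed ball, the intermediate value theorem would give another time at
    distance exactly \<open>\<rho>\<close>; so the last time itself is at that distance.\<close>
  have "\<exists>t\<ge>s'. t \<le> b \<and> dist (\<gamma> s) (\<gamma> t) = \<rho>"
    using s' far by (intro IVT' continuous_on_subset[OF cs]) (auto simp: K_def)
  then obtain t where t: "s' \<le> t" "t \<le> b" "dist (\<gamma> s) (\<gamma> t) = \<rho>" by auto
  then have "t \<in> K" using s'(1) by (simp add: K_def)
  with t s'(2) have eq: "dist (\<gamma> s) (\<gamma> s') = \<rho>" by force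
  have later: "\<rho> \<le> dist (\<gamma> s) (\<gamma> t)" if "t \<in> {s'..b}" for t
  proof (rule ccontr)
    assume *: "\<not> \<rho> \<le> dist (\<gamma> s) (\<gamma> t)"
    then have "t \<in> K" using that s' by (auto simp: K_def)
    with s'(2) that have "t = s'" by force
    with * eq show False by simp
  qed
  have ss: "s \<le> s'" "s' \<le> b" using s' by (auto simp: K_def)
  have "real N * \<rho> \<le> dist (\<gamma> s') (\<gamma> b)"
    using Suc.prems(3) eq dist_triangle[of "\<gamma> s" "\<gamma> b" "\<gamma> s'"] by (simp add: algebra_simps)
  with Suc.IH[of s'] ss Suc.prems obtain xs where xs: "length xs = N"
    "xs \<noteq> [] \<longrightarrow> hd xs = \<gamma> s'" "set xs \<subseteq> \<gamma> ` {s'..b}" "sorted_wrt (\<lambda>x y. \<rho> \<le> dist x y) xs"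
    "successively (\<lambda>x y. dist x y \<le> \<rho>) xs" "\<delta> * real (length (filter G xs)) \<le> integral {s'..b} f"
    by auto
  have split: "integral {s..b} f = integral {s..s'} f + integral {s'..b} f"
    using ss Suc.prems
    by (intro Henstock_Kurzweil_Integration.integral_combine[symmetric]
        integrable_subinterval_real[OF f]) auto
  show ?case
  proof (intro exI[of _ "\<gamma> s # xs"] conjI)
    show "set (\<gamma> s # xs) \<subseteq> \<gamma> ` {s..b}" using xs(3) ss by force
    show "sorted_wrt (\<lambda>x y. \<rho> \<le> dist x y) (\<gamma> s # xs)" using xs(3,4) later by auto
    show "successively (\<lambda>x y. dist x y \<le> \<rho>) (\<gamma> s # xs)"
      using xs(2,5) eq by (auto simp: successively_Cons)
    show "\<delta> * real (length (filter G (\<gamma> s # xs))) \<le> integral {s..b} f"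
      using xs(6) split cost[of s s'] ss eq Suc.prems
      by (auto simp: algebra_simps split: if_splits)
  qed (use xs in auto)
qed

section \<open>Leaving an elliptic ball\<close>

text \<open>The quadratic form is bounded below by \<open>\<delta>\<^sup>2\<close>, so that lengths are bounded below by \<open>\<delta>\<close>.\<close>

definition elliptic :: "real \<Rightarrow> (real^'n^'n) set" where
  "elliptic \<delta> = {A. \<forall>v. \<delta>\<^sup>2 * (v \<bullet> v) \<le> v \<bullet> (A *v v)}"

lemma continuous_on_matrix_vector_mult:
  fixes A :: "'a::topological_space \<Rightarrow> real^'n^'m"
  assumes "continuous_on S A" "continuous_on S w"
  shows "continuous_on S (\<lambda>t. A t *v w t)"
  unfolding matrix_vector_mult_def
  by (intro continuous_on_vec_lambda continuous_intros assms)

lemma closed_elliptic: "closed (elliptic \<delta> :: (real^'n^'n) set)"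
proof -
  have "closed {A::real^'n^'n. \<delta>\<^sup>2 * (v \<bullet> v) \<le> v \<bullet> (A *v v)}" for v :: "real^'n"
    by (intro closed_Collect_le continuous_intros continuous_on_matrix_vector_mult)
  then show ?thesis unfolding elliptic_def by (simp add: closed_Collect_all)
qed

lemma ellipticD: "A \<in> elliptic \<delta> \<Longrightarrow> 0 \<le> \<delta> \<Longrightarrow> \<delta> * norm v \<le> sqrt (v \<bullet> (A *v v))"
  by (rule real_le_rsqrt) (simp add: elliptic_def power_mult_distrib power2_norm_eq_inner)

text \<open>Up to the first time \<open>e\<close> at distance \<open>r\<close> the curve stays in the ball, where its speed for \<open>g\<close> is at
  least \<open>\<delta>\<close> times its Euclidean speed. What happens after \<open>e\<close> only adds length, so the ball may be
  much smaller than the distance travelled in total.\<close>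

lemma length_leaving_elliptic_ball:
  fixes g :: "real^'n \<Rightarrow> real^'n^'n"
  assumes D: "\<And>t. t \<in> {s..u} \<Longrightarrow> (\<gamma> has_vector_derivative D t) (at t within {s..u})"
    and cD: "continuous_on {s..u} D" and cg: "continuous_on UNIV g" and \<delta>: "0 \<le> \<delta>"
    and psd: "\<And>x v. 0 \<le> v \<bullet> (g x *v v)"
    and ell: "\<And>x. x \<in> cball (\<gamma> s) r \<Longrightarrow> g x \<in> elliptic \<delta>"
    and su: "s \<le> u" "r \<le> dist (\<gamma> s) (\<gamma> u)" and r: "0 \<le> r"
  shows "\<delta> * r \<le> integral {s..u} (\<lambda>t. sqrt (D t \<bullet> (g (\<gamma> t) *v D t)))"
proof -
  let ?f = "\<lambda>t. sqrt (D t \<bullet> (g (\<gamma> t) *v D t))"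
  have c\<gamma>: "continuous_on {s..u} \<gamma>"
    using D by (meson continuous_on_eq_continuous_within has_vector_derivative_continuous)
  have cf: "continuous_on {s..u} ?f"
    by (intro continuous_intros continuous_on_matrix_vector_mult cD
        continuous_on_compose2[OF cg c\<gamma>]) auto
  have cs: "continuous_on {s..u} (\<lambda>t. dist (\<gamma> s) (\<gamma> t))"
    by (intro continuous_intros c\<gamma>)
  define K where "K = {t \<in> {s..u}. r \<le> dist (\<gamma> s) (\<gamma> t)}"
  have "K = {s..u} \<inter> (\<lambda>t. dist (\<gamma> s) (\<gamma> t)) -` {r..}" by (auto simp: K_def)
  then have "closed K" using cs by (simp add: continuous_closed_preimage)
  moreover have "bounded K" unfolding K_def by (rule bounded_subset[of "{s..u}"]) auto
  ultimately have "compact K" by (simp add: compact_eq_bounded_closed)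
  moreover have "u \<in> K" using su by (simp add: K_def)
  ultimately obtain e where e: "e \<in> K" "\<And>t. t \<in> K \<Longrightarrow> e \<le> t"
    using compact_attains_inf[of K] by auto
  have se: "s \<le> e" "e \<le> u" using e by (auto simp: K_def)
  have "\<exists>t\<ge>s. t \<le> e \<and> dist (\<gamma> s) (\<gamma> t) = r"
    using e r se by (intro IVT' continuous_on_subset[OF cs]) (auto simp: K_def)
  then have eq: "dist (\<gamma> s) (\<gamma> e) = r" using e se by (force simp: K_def)
  have inside: "\<gamma> t \<in> cball (\<gamma> s) r" if "t \<in> {s..e}" for t
  proof (cases "t = e")
    case False
    then have "t \<notin> K" using e(2)[of t] that by auto
    then show ?thesis using that se by (auto simp: K_def)
  qed (use eq in auto)
  have int: "?f integrable_on {s..e}"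
    using se by (intro integrable_continuous_real continuous_on_subset[OF cf]) auto
  have "(D has_integral (\<gamma> e - \<gamma> s)) {s..e}"
    using se by (intro fundamental_theorem_of_calculus has_vector_derivative_within_subset[OF D]) auto
  then have "norm (\<gamma> e - \<gamma> s) \<le> integral {s..e} (\<lambda>t. norm (D t))"
    using se by (metis continuous_on_subset[OF cD] continuous_on_norm integrable_continuous_real
        integral_unique integral_norm_bound_integral atLeastatMost_subset_iff order_refl has_integral_integrable)
  then have "\<delta> * r \<le> \<delta> * integral {s..e} (\<lambda>t. norm (D t))"
    using eq \<delta> by (intro mult_left_mono) (auto simp: dist_norm norm_minus_commute)
  also have "\<dots> = integral {s..e} (\<lambda>t. \<delta> * norm (D t))" by simp
  also have "\<dots> \<le> integral {s..e} ?f"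
    using se inside \<delta> by (intro integral_le int ellipticD ell integrable_continuous_real
        continuous_intros continuous_on_subset[OF cD]) auto
  also have "\<dots> \<le> integral {s..u} ?f"
    using se psd by (intro integral_subset_le int integrable_continuous_real cf) auto
  finally show ?thesis .
qed

section \<open>Lattice paths\<close>

definition lattice_round :: "real^'n \<Rightarrow> real^'n" where
  "lattice_round x = (\<chi> i. of_int (round (x $ i)))"

definition lattice_steps :: "real \<Rightarrow> (real^'n) set" where
  "lattice_steps r = {z. (\<forall>i. z $ i \<in> \<int>) \<and> norm z \<le> r}"

lemma norm_lattice_round: "norm (x - lattice_round x) \<le> real CARD('n)" for x :: "real^'n"
proof -
  have "norm (x - lattice_round x) \<le> (\<Sum>i\<in>UNIV. \<bar>(x - lattice_round x) $ i\<bar>)"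
    by (rule norm_le_l1_cart)
  also have "\<dots> \<le> (\<Sum>i\<in>(UNIV::'n set). 1)"
  proof (rule sum_mono)
    fix i
    show "\<bar>(x - lattice_round x) $ i\<bar> \<le> 1"
      using of_int_round_abs_le[of "x $ i"] by (simp add: lattice_round_def abs_minus_commute)
  qed
  finally show ?thesis by simp
qed

lemma finite_lattice_steps: "finite (lattice_steps r :: (real^'n) set)"
proof -
  let ?I = "{of_int k |k. k \<in> {-\<lceil>r\<rceil>..\<lceil>r\<rceil>}} :: real set"
  have fin: "finite ?I" by simp
  have "lattice_steps r \<subseteq> (vec_lambda ` {f. \<forall>i. f i \<in> ?I} :: (real^'n) set)"
  proof
    fix z :: "real^'n" assume z: "z \<in> lattice_steps r"
    have "z $ i \<in> ?I" for i
    proof -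
      obtain k where k: "z $ i = of_int k" using z by (auto simp: lattice_steps_def elim: Ints_cases)
      have "\<bar>z $ i\<bar> \<le> r" using z component_le_norm_cart[of z i] by (auto simp: lattice_steps_def)
      then have "k \<in> {-\<lceil>r\<rceil>..\<lceil>r\<rceil>}" unfolding k by (auto simp: abs_le_iff) linarith+
      with k show ?thesis by blast
    qed
    then show "z \<in> vec_lambda ` {f. \<forall>i. f i \<in> ?I}"
      by (intro image_eqI[of _ _ "\<lambda>i. z $ i"]) auto
  qed
  moreover have "finite {f :: 'n \<Rightarrow> real. \<forall>i. f i \<in> ?I}"
    using finite_set_of_finite_funs[of "UNIV :: 'n set" ?I undefined] fin by simp
  ultimately show ?thesis by (meson finite_imageI finite_subset)
qed

lemma card_paths:
  fixes S :: "'a::ab_group_add set"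
  assumes "finite S"
  defines "paths N z \<equiv> {zs. length zs = N \<and> successively (\<lambda>z w. w - z \<in> S) (z # zs)}"
  shows "finite (paths N z) \<and> card (paths N z) \<le> card S ^ N"
proof (induction N arbitrary: z)
  case 0
  have "paths 0 z = {[]}" by (auto simp: paths_def)
  then show ?case by simp
next
  case (Suc N)
  have eq: "paths (Suc N) z = (\<Union>s\<in>S. (#) (z + s) ` paths N (z + s))"
  proof (intro equalityI subsetI)
    fix zs assume "zs \<in> paths (Suc N) z"
    then obtain w ws where "zs = w # ws" "length ws = N" "w - z \<in> S"
      "successively (\<lambda>z w. w - z \<in> S) (w # ws)"
      by (cases zs) (auto simp: paths_def)
    then show "zs \<in> (\<Union>s\<in>S. (#) (z + s) ` paths N (z + s))"
      by (intro UN_I[of "w - z"]) (auto simp: paths_def)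
  qed (auto simp: paths_def)
  have "card (paths (Suc N) z) \<le> (\<Sum>s\<in>S. card ((#) (z + s) ` paths N (z + s)))"
    unfolding eq by (rule card_UN_le[OF assms(1)])
  also have "\<dots> \<le> (\<Sum>s\<in>S. card S ^ N)"
    using Suc by (intro sum_mono) (simp add: card_image)
  finally show ?case using Suc eq assms(1) by auto
qed

section \<open>Degenerate balls and the length of curves\<close>

text \<open>The radius leaves room for rounding the centre: a point is within \<open>d\<close> of the lattice point \<open>z\<close> that
  it is rounded to, so its unit ball is contained in the ball around \<open>z\<close>.\<close>

definition degenerate :: "real \<Rightarrow> real^'n \<Rightarrow> (real^'n \<Rightarrow> real^'n^'n) set" where
  "degenerate \<delta> z = {g \<in> metrics. \<exists>x\<in>cball z (real CARD('n) + 1). g x \<notin> elliptic \<delta>}"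

text \<open>Continuity of \<open>g\<close> and closedness of the elliptic matrices reduce the uncountable condition in
  \<open>degenerate\<close> to countably many points; this is what makes the event measurable, also with respect to
  the field restricted to the ball.\<close>

lemma ex_nonelliptic_dense:
  fixes g :: "real^'n \<Rightarrow> real^'n^'n"
  assumes g: "g \<in> metrics" and D: "D \<subseteq> A" "A \<subseteq> closure D"
  shows "(\<exists>x\<in>A. g x \<notin> elliptic \<delta>) \<longleftrightarrow> (\<exists>x\<in>D. g x \<notin> elliptic \<delta>)"
proof -
  have "closed (g -` elliptic \<delta>)"
    using g by (intro closed_vimage closed_elliptic) (simp add: metrics_def)
  then have "D \<subseteq> g -` elliptic \<delta> \<Longrightarrow> A \<subseteq> g -` elliptic \<delta>"
    using D(2) closure_minimal by blast
  with D(1) show ?thesis by blast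
qed

lemma space_cylinder_algebra: "space cylinder_algebra = metrics"
  unfolding cylinder_algebra_def by (rule space_measure_of) auto

lemma metrics_psd: "g \<in> metrics \<Longrightarrow> 0 \<le> v \<bullet> (g x *v v)"
  by (cases "v = 0") (auto simp: metrics_def spd_def less_imp_le)

text \<open>The quadratic form attains a positive minimum on the compact product of the ball with the unit
  sphere, and homogeneity extends the bound to all vectors.\<close>

lemma metric_elliptic_on_ball:
  fixes g :: "real^'n \<Rightarrow> real^'n^'n"
  assumes g: "g \<in> metrics" and r: "0 \<le> r"
  shows "\<exists>\<delta>>0. \<forall>x\<in>cball z r. g x \<in> elliptic \<delta>"
proof -
  let ?q = "\<lambda>(x, v). v \<bullet> (g x *v v)"
  have cg: "continuous_on UNIV g" using g by (simp add: metrics_def)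
  have "compact (cball z r \<times> sphere 0 1 :: ((real^'n) \<times> (real^'n)) set)"
    by (intro compact_Times compact_cball compact_sphere)
  moreover obtain u :: "real^'n" where "norm u = 1" using vector_choose_size[of 1] by auto
  then have "(z, u) \<in> cball z r \<times> sphere 0 1" using r by simp
  moreover have "continuous_on (cball z r \<times> sphere 0 1) ?q"
    unfolding case_prod_beta
    by (intro continuous_intros continuous_on_matrix_vector_mult continuous_on_compose2[OF cg]) auto
  ultimately obtain x0 v0 where m: "norm v0 = 1"
    "\<And>x v. x \<in> cball z r \<Longrightarrow> norm v = 1 \<Longrightarrow> v0 \<bullet> (g x0 *v v0) \<le> v \<bullet> (g x *v v)"
    using continuous_attains_inf[of "cball z r \<times> sphere 0 1" ?q] by fastforce
  define c where "c = v0 \<bullet> (g x0 *v v0)"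
  have c: "0 < c" using m(1) g unfolding c_def metrics_def spd_def by (metis (mono_tags, lifting) mem_Collect_eq norm_zero zero_neq_one)
  have "c * (v \<bullet> v) \<le> v \<bullet> (g x *v v)" if x: "x \<in> cball z r" for x v
  proof (cases "v = 0")
    case False
    let ?w = "(1 / norm v) *\<^sub>R v"
    have "c \<le> ?w \<bullet> (g x *v ?w)" unfolding c_def using False by (intro m(2)[OF x]) simp
    also have "\<dots> = (v \<bullet> (g x *v v)) / (v \<bullet> v)"
      by (simp add: matrix_vector_mult_scaleR power2_norm_eq_inner[symmetric] power2_eq_square)
    finally show ?thesis using False by (simp add: field_simps)
  qed simp
  then show ?thesis using c by (intro exI[of _ "sqrt c"]) (auto simp: elliptic_def)
qed

text \<open>The points of \<open>last_exit_chain\<close> are rounded to the lattice. Rounding changes distances by at most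
  \<open>2d\<close>, which weakens separation and step size accordingly. A chain point whose rounded ball is not
  degenerate is surrounded by a unit ball on which \<open>g\<close> is elliptic, and leaving it costs \<open>\<delta>\<close>.\<close>

lemma many_elliptic_balls_along_curve:
  fixes g :: "real^'n \<Rightarrow> real^'n^'n"
  defines "d \<equiv> real CARD('n)"
  assumes g: "g \<in> metrics" and \<gamma>: "C1_curve a b \<gamma>" "\<gamma> a = 0"
    and \<rho>: "1 \<le> \<rho>" and \<delta>: "0 \<le> \<delta>" and far: "real N * \<rho> \<le> norm (\<gamma> b)"
  shows "\<exists>zs. length zs = N \<and> successively (\<lambda>z w. w - z \<in> lattice_steps (\<rho> + 2 * d)) (0 # zs)
    \<and> sorted_wrt (\<lambda>z w. \<rho> - 2 * d \<le> dist z w) zs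
    \<and> \<delta> * real (length (filter (\<lambda>z. g \<notin> degenerate \<delta> z) zs)) \<le> riem_length g a b \<gamma>"
proof -
  obtain D where ab: "a < b" and cD: "continuous_on {a..b} D"
    and D: "\<And>t. t \<in> {a..b} \<Longrightarrow> (\<gamma> has_vector_derivative D t) (at t within {a..b})"
    using \<gamma>(1) by (auto simp: C1_curve_def)
  define f where "f t = sqrt (D t \<bullet> (g (\<gamma> t) *v D t))" for t
  have c\<gamma>: "continuous_on {a..b} \<gamma>"
    using D by (meson continuous_on_eq_continuous_within has_vector_derivative_continuous)
  have cg: "continuous_on UNIV g" using g by (simp add: metrics_def)
  have cf: "continuous_on {a..b} f" unfolding f_def
    by (intro continuous_intros continuous_on_matrix_vector_mult cD
        continuous_on_compose2[OF cg c\<gamma>]) auto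
  have int: "f integrable_on {s..u}" if "a \<le> s" "u \<le> b" for s u
    using that by (intro integrable_continuous_real continuous_on_subset[OF cf]) auto
  have len: "riem_length g a b \<gamma> = integral {a..b} f"
    unfolding riem_length_def f_def Let_def
    using vector_derivative_within_closed_interval[OF ab _ D] by (intro integral_cong) simp
  define G where "G = (\<lambda>x. g \<notin> degenerate \<delta> (lattice_round x))"
  have cost: "of_bool (G (\<gamma> s)) * \<delta> \<le> integral {s..u} f"
    if su: "a \<le> s" "s \<le> u" "u \<le> b" "dist (\<gamma> s) (\<gamma> u) = \<rho>" for s u
  proof (cases "G (\<gamma> s)")
    case True
    have "g x \<in> elliptic \<delta>" if "x \<in> cball (\<gamma> s) 1" for x
    proof -
      have "dist (lattice_round (\<gamma> s)) x \<le> d + 1"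
        using that norm_lattice_round[of "\<gamma> s"] dist_triangle[of "lattice_round (\<gamma> s)" x "\<gamma> s"]
        by (simp add: d_def dist_norm norm_minus_commute)
      then show ?thesis using True g by (auto simp: G_def degenerate_def d_def)
    qed
    then have "\<delta> * 1 \<le> integral {s..u} f" unfolding f_def
      using su \<rho> metrics_psd[OF g]
      by (intro length_leaving_elliptic_ball cg \<delta> continuous_on_subset[OF cD]
          has_vector_derivative_within_subset[OF D]) auto
    with True show ?thesis by simp
  next
    case False
    have "0 \<le> integral {s..u} f"
      using su metrics_psd[OF g] by (intro integral_nonneg int) (auto simp: f_def)
    with False show ?thesis by simp
  qed
  have "\<exists>xs. length xs = N \<and> (xs \<noteq> [] \<longrightarrow> hd xs = \<gamma> a) \<and> set xs \<subseteq> \<gamma> ` {a..b}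
      \<and> sorted_wrt (\<lambda>x y. \<rho> \<le> dist x y) xs \<and> successively (\<lambda>x y. dist x y \<le> \<rho>) xs
      \<and> \<delta> * real (length (filter G xs)) \<le> integral {a..b} f"
    using ab \<rho> far \<gamma>(2) metrics_psd[OF g]
    by (intro last_exit_chain[OF c\<gamma> int _ cost]) (simp_all add: f_def)
  then obtain xs where xs: "length xs = N" "xs \<noteq> [] \<longrightarrow> hd xs = 0"
    "sorted_wrt (\<lambda>x y. \<rho> \<le> dist x y) xs" "successively (\<lambda>x y. dist x y \<le> \<rho>) xs"
    "\<delta> * real (length (filter G xs)) \<le> integral {a..b} f"
    using \<gamma>(2) by auto
  have round_dist: "\<bar>dist (lattice_round x) (lattice_round y) - dist x y\<bar> \<le> 2 * d"
    for x y :: "real^'n"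
    using norm_lattice_round[of x] norm_lattice_round[of y]
      dist_triangle[of x y "lattice_round x"] dist_triangle[of "lattice_round x" y "lattice_round y"]
      dist_triangle[of "lattice_round x" "lattice_round y" x] dist_triangle[of x "lattice_round y" y]
    by (simp add: d_def dist_norm norm_minus_commute)
  have step: "lattice_round y - lattice_round x \<in> lattice_steps (\<rho> + 2 * d)"
    if "dist x y \<le> \<rho>" for x y :: "real^'n"
    using that round_dist[of x y]
    by (auto simp: lattice_steps_def lattice_round_def dist_norm norm_minus_commute)
  have r0: "lattice_round (0::real^'n) = 0" by (simp add: lattice_round_def vec_eq_iff)
  show ?thesis
  proof (intro exI[of _ "map lattice_round xs"] conjI)
    have "successively (\<lambda>x y. dist x y \<le> \<rho>) (0 # xs)"
      using xs(2,4) \<rho> by (auto simp: successively_Cons)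
    then have "successively (\<lambda>x y. lattice_round y - lattice_round x \<in> lattice_steps (\<rho> + 2 * d)) (0 # xs)"
      by (rule successively_mono) (use step in auto)
    then have "successively (\<lambda>z w. w - z \<in> lattice_steps (\<rho> + 2 * d)) (map lattice_round (0 # xs))"
      by (simp only: successively_map)
    then show "successively (\<lambda>z w. w - z \<in> lattice_steps (\<rho> + 2 * d)) (0 # map lattice_round xs)"
      by (simp only: list.map r0)
    have "\<rho> - 2 * d \<le> dist (lattice_round x) (lattice_round y)" if "\<rho> \<le> dist x y"
      for x y :: "real^'n" using that round_dist[of x y] by linarith
    then show "sorted_wrt (\<lambda>z w. \<rho> - 2 * d \<le> dist z w) (map lattice_round xs)"
      unfolding sorted_wrt_map by (intro sorted_wrt_mono_rel[OF _ xs(3)])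
    show "\<delta> * real (length (filter (\<lambda>z. g \<notin> degenerate \<delta> z) (map lattice_round xs)))
        \<le> riem_length g a b \<gamma>"
      using xs(5) by (simp add: len filter_map o_def G_def)
  qed (use xs in simp)
qed

text \<open>The straight segment shows that the infimum is over a nonempty set.\<close>

lemma riem_dist_geI:
  assumes "\<And>a b \<gamma>. C1_curve a b \<gamma> \<Longrightarrow> \<gamma> a = x \<Longrightarrow> \<gamma> b = y \<Longrightarrow> l \<le> riem_length g a b \<gamma>"
  shows "l \<le> riem_dist g x y"
  unfolding riem_dist_def
proof (rule cInf_greatest)
  have "C1_curve 0 1 (\<lambda>t. x + t *\<^sub>R (y - x))"
    unfolding C1_curve_def
    by (auto intro!: exI[of _ "\<lambda>_. y - x"] derivative_eq_intros)
  then show "{riem_length g a b \<gamma> |a b \<gamma>. C1_curve a b \<gamma> \<and> \<gamma> a = x \<and> \<gamma> b = y} \<noteq> {}"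
    by (simp, intro exI[of _ 0] exI[of _ 1] exI[of _ "\<lambda>t. x + t *\<^sub>R (y - x)"]) simp
qed (use assms in blast)

section \<open>Probability of degenerate balls\<close>

locale random_metric = prob_space P for P :: "(real^'n \<Rightarrow> real^'n^'n) measure" +
  assumes sets_P: "sets P = sets cylinder_algebra"
begin

lemma space_P: "space P = metrics"
  using sets_eq_imp_space_eq[OF sets_P] by (simp add: space_cylinder_algebra)

lemma cylinder_in_sets:
  assumes "finite F" "\<And>x. B x \<in> sets borel"
  shows "{g \<in> metrics. \<forall>x\<in>F. g x \<in> B x} \<in> sets P"
  unfolding sets_P cylinder_algebra_def using assms by (intro in_measure_of) auto

lemma measurable_evaluation [measurable]: "(\<lambda>g. g x) \<in> borel_measurable P"
proof (rule measurableI)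
  fix B :: "(real^'n^'n) set" assume "B \<in> sets borel"
  then have "{g \<in> metrics. \<forall>y\<in>{x}. g y \<in> B} \<in> sets P" by (intro cylinder_in_sets) auto
  also have "{g \<in> metrics. \<forall>y\<in>{x}. g y \<in> B} = (\<lambda>g. g x) -` B \<inter> space P" by (auto simp: space_P)
  finally show "(\<lambda>g. g x) -` B \<inter> space P \<in> sets P" .
qed auto

lemma measurable_translation: "(\<lambda>g x. g (x + z)) \<in> measurable P P"
proof -
  have maps: "(\<lambda>x. g (x + z)) \<in> metrics" if "g \<in> metrics" for g :: "real^'n \<Rightarrow> real^'n^'n"
    using that unfolding metrics_def
    by (auto intro!: continuous_intros intro: continuous_on_compose2[of UNIV g])
  have "(\<lambda>g x. g (x + z)) \<in> measurable P (cylinder_algebra :: (real^'n \<Rightarrow> real^'n^'n) measure)"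
    unfolding cylinder_algebra_def
  proof (rule measurable_measure_of, goal_cases)
    case (3 Y)
    then obtain F B where Y: "Y = {g \<in> metrics. \<forall>x\<in>F. g x \<in> B x}" "finite F"
      "\<And>x. B x \<in> sets borel" by auto
    have "{g \<in> metrics. \<forall>x\<in>(\<lambda>x. x + z) ` F. g x \<in> B (x - z)} \<in> sets P"
      using Y by (intro cylinder_in_sets) auto
    also have "{g \<in> metrics. \<forall>x\<in>(\<lambda>x. x + z) ` F. g x \<in> B (x - z)} = (\<lambda>g x. g (x + z)) -` Y \<inter> space P"
      using maps by (auto simp: Y space_P)
    finally show ?case .
  qed (use maps in \<open>auto simp: space_P\<close>)
  then show ?thesis using measurable_cong_sets[OF refl sets_P] by auto
qed

lemma sets_degenerate [measurable]: "degenerate \<delta> z \<in> sets P"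
proof -
  obtain D where D: "countable D" "D \<subseteq> cball z (real CARD('n) + 1)"
    "cball z (real CARD('n) + 1) \<subseteq> closure D"
    by (rule separable)
  note closed_elliptic[THEN borel_closed, measurable]
  have "degenerate \<delta> z = {g \<in> space P. \<exists>x\<in>D. g x \<notin> elliptic \<delta>}"
    unfolding degenerate_def space_P using ex_nonelliptic_dense[OF _ D(2,3)] by blast
  also have "\<dots> \<in> sets P" using D(1) by measurable
  finally show ?thesis .
qed

lemma prob_degenerate_translate:
  assumes "translation_invariant P"
  shows "prob (degenerate \<delta> z) = prob (degenerate \<delta> 0)"
proof -
  have "prob (degenerate \<delta> 0) = measure (distr P P (\<lambda>g x. g (x + z))) (degenerate \<delta> 0)"
    using assms by (simp add: translation_invariant_def)
  also have "\<dots> = prob ((\<lambda>g x. g (x + z)) -` degenerate \<delta> 0 \<inter> space P)"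
    by (rule measure_distr[OF measurable_translation sets_degenerate])
  also have "(\<lambda>g x. g (x + z)) -` degenerate \<delta> 0 \<inter> space P = degenerate \<delta> z"
  proof -
    have maps: "(\<lambda>x. g (x + z)) \<in> metrics" if "g \<in> metrics" for g :: "real^'n \<Rightarrow> real^'n^'n"
      using measurable_space[OF measurable_translation] that by (simp add: space_P)
    have "(\<exists>x\<in>cball 0 r. g (x + z) \<notin> E) \<longleftrightarrow> (\<exists>x\<in>cball z r. g x \<notin> E)"
      for g :: "real^'n \<Rightarrow> real^'n^'n" and r E
    proof -
      have "cball z r = (\<lambda>x. x + z) ` cball 0 r"
        using cball_translation[of z 0 r] by (simp add: add.commute)
      then show ?thesis by simp
    qed
    with maps show ?thesis by (auto simp: degenerate_def space_P)
  qed
  finally show ?thesis by simp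
qed

text \<open>The events decrease to the empty set: by \<open>metric_elliptic_on_ball\<close> each single metric is elliptic on
  the ball with some positive constant.\<close>

lemma prob_degenerate_tendsto_0: "(\<lambda>k. prob (degenerate (1 / real (Suc k)) z)) \<longlonglongrightarrow> 0"
proof -
  have mono: "elliptic \<delta> \<subseteq> (elliptic \<epsilon> :: (real^'n^'n) set)" if "0 \<le> \<epsilon>" "\<epsilon> \<le> \<delta>" for \<epsilon> \<delta>
    unfolding elliptic_def using that
    by (auto intro: order_trans[OF mult_right_mono[OF power_mono]])
  have "(\<lambda>k. prob (degenerate (1 / real (Suc k)) z)) \<longlonglongrightarrow> prob (\<Inter>k. degenerate (1 / real (Suc k)) z)"
  proof (rule finite_Lim_measure_decseq)
    have "elliptic (1 / real (Suc m)) \<subseteq> (elliptic (1 / real (Suc n)) :: (real^'n^'n) set)"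
      if "m \<le> n" for m n using that by (intro mono) (auto simp: frac_le)
    then show "decseq (\<lambda>k. degenerate (1 / real (Suc k)) z)"
      unfolding decseq_def degenerate_def by blast
  qed auto
  moreover have "g \<notin> (\<Inter>k. degenerate (1 / real (Suc k)) z)" for g
  proof (cases "g \<in> metrics")
    case True
    then obtain \<delta> where \<delta>: "\<delta> > 0" "\<forall>x\<in>cball z (real CARD('n) + 1). g x \<in> elliptic \<delta>"
      using metric_elliptic_on_ball[of g "real CARD('n) + 1" z] by auto
    obtain k where "1 / real (Suc k) < \<delta>" using nat_approx_posE[OF \<delta>(1)] by blast
    then have "elliptic \<delta> \<subseteq> (elliptic (1 / real (Suc k)) :: (real^'n^'n) set)" by (intro mono) auto
    with \<delta>(2) have "g \<notin> degenerate (1 / real (Suc k)) z" by (auto simp: degenerate_def)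
    then show ?thesis by blast
  qed (auto simp: degenerate_def)
  then have "(\<Inter>k. degenerate (1 / real (Suc k)) z) = {}" by blast
  ultimately show ?thesis by simp
qed

text \<open>Independence of two regions suffices, by induction: the ball around a new centre is at distance
  at least \<open>R\<close> from the union of all the previous balls, and the whole previous event only
  depends on the field on that union.\<close>

lemma prob_all_degenerate:
  assumes inv: "translation_invariant P"
    and indep: "\<And>A B. (\<forall>x\<in>A. \<forall>y\<in>B. R \<le> norm (x - y)) \<Longrightarrow>
        indep_var (\<Pi>\<^sub>M x\<in>A. borel) (\<lambda>g. restrict g A) (\<Pi>\<^sub>M y\<in>B. borel) (\<lambda>g. restrict g B)"
    and "finite T"
    and "pairwise (\<lambda>z w. R + 2 * (real CARD('n) + 1) \<le> dist z w) T"
  shows "prob {g \<in> space P. \<forall>z\<in>T. g \<in> degenerate \<delta> z} = prob (degenerate \<delta> 0) ^ card T"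
  using assms(3,4)
proof (induction T)
  case empty
  then show ?case by (simp add: prob_space)
next
  case (insert z T)
  let ?N = "\<lambda>z::real^'n. cball z (real CARD('n) + 1)"
  have "\<forall>w. \<exists>D. countable D \<and> D \<subseteq> ?N w \<and> ?N w \<subseteq> closure D"
  proof
    fix w :: "real^'n"
    obtain D where "countable D" "D \<subseteq> ?N w" "?N w \<subseteq> closure D" by (rule separable)
    then show "\<exists>D. countable D \<and> D \<subseteq> ?N w \<and> ?N w \<subseteq> closure D" by blast
  qed
  from choice[OF this] obtain D where
    "\<forall>w. countable (D w) \<and> D w \<subseteq> ?N w \<and> ?N w \<subseteq> closure (D w)" by blast
  then have D: "\<And>w. countable (D w)" "\<And>w. D w \<subseteq> ?N w" "\<And>w. ?N w \<subseteq> closure (D w)" by simp_all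
  note closed_elliptic[THEN borel_closed, measurable]
  define A where "A = ?N z"
  define B where "B = (\<Union>w\<in>T. ?N w)"
  define X where "X = {h \<in> space (\<Pi>\<^sub>M x\<in>A. borel). \<exists>x\<in>D z. h x \<notin> (elliptic \<delta> :: (real^'n^'n) set)}"
  define Y where "Y = {h \<in> space (\<Pi>\<^sub>M x\<in>B. borel). \<forall>w\<in>T. \<exists>x\<in>D w. h x \<notin> (elliptic \<delta> :: (real^'n^'n) set)}"
  have far: "R + 2 * (real CARD('n) + 1) \<le> dist z w" if "w \<in> T" for w
    using insert.prems insert.hyps(2) that by (auto simp: pairwise_insert)
  have "R \<le> norm (x - y)" if xy: "x \<in> A" "y \<in> B" for x y
  proof -
    obtain w where w: "w \<in> T" "dist w y \<le> real CARD('n) + 1" "dist z x \<le> real CARD('n) + 1"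
      using xy by (auto simp: A_def B_def)
    then show ?thesis
      using far[OF w(1)] dist_triangle[of z w x] dist_triangle[of x w y]
      by (simp add: dist_norm[symmetric] dist_commute[of y w])
  qed
  then have ind: "indep_var (\<Pi>\<^sub>M x\<in>A. borel) (\<lambda>g. restrict g A) (\<Pi>\<^sub>M y\<in>B. borel) (\<lambda>g. restrict g B)"
    by (intro indep) blast
  have meas: "{h \<in> space (\<Pi>\<^sub>M x\<in>C. borel). \<exists>x\<in>D w. h x \<notin> (elliptic \<delta> :: (real^'n^'n) set)}
      \<in> sets (\<Pi>\<^sub>M x\<in>C. borel)" if "D w \<subseteq> C" for C w
  proof (intro sets.sets_Collect_countable_Ex' D(1))
    fix x assume "x \<in> D w"
    then have [measurable]: "(\<lambda>h. h x) \<in> measurable (\<Pi>\<^sub>M x\<in>C. borel) (borel :: (real^'n^'n) measure)"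
      using that by (intro measurable_component_singleton) blast
    show "{h \<in> space (\<Pi>\<^sub>M x\<in>C. borel). h x \<notin> (elliptic \<delta> :: (real^'n^'n) set)}
        \<in> sets (\<Pi>\<^sub>M x\<in>C. borel)" by measurable
  qed
  have DA: "D z \<subseteq> A" unfolding A_def by (rule D(2))
  have DB: "D w \<subseteq> B" if "w \<in> T" for w unfolding B_def using D(2)[of w] that by blast
  have "X \<in> sets (\<Pi>\<^sub>M x\<in>A. borel)" unfolding X_def by (rule meas[OF DA])
  moreover have "Y \<in> sets (\<Pi>\<^sub>M x\<in>B. borel)"
    unfolding Y_def using insert.hyps(1)
    by (intro sets.sets_Collect_countable_All' meas DB countable_finite)
  ultimately have "prob ((\<lambda>g. (restrict g A, restrict g B)) -` (X \<times> Y) \<inter> space P)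
      = prob ((\<lambda>g. restrict g A) -` X \<inter> space P) * prob ((\<lambda>g. restrict g B) -` Y \<inter> space P)"
    by (rule indep_varD[OF ind])
  note prod = this
  have iff: "(\<exists>x\<in>D w. restrict g C x \<notin> elliptic \<delta>) \<longleftrightarrow> g \<in> degenerate \<delta> w"
    if "g \<in> space P" "D w \<subseteq> C" for g C w
  proof -
    have "(\<exists>x\<in>D w. restrict g C x \<notin> elliptic \<delta>) \<longleftrightarrow> (\<exists>x\<in>D w. g x \<notin> elliptic \<delta>)"
      using that(2) by (intro bex_cong) auto
    also have "\<dots> \<longleftrightarrow> (\<exists>x\<in>?N w. g x \<notin> elliptic \<delta>)"
      using that(1) by (intro ex_nonelliptic_dense[symmetric] D) (simp add: space_P)
    finally show ?thesis using that(1) by (simp add: degenerate_def space_P)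
  qed
  have X: "restrict g A \<in> X \<longleftrightarrow> g \<in> degenerate \<delta> z" if "g \<in> space P" for g
    unfolding X_def using iff[OF that DA] by (simp add: space_PiM)
  have Y: "restrict g B \<in> Y \<longleftrightarrow> (\<forall>w\<in>T. g \<in> degenerate \<delta> w)" if "g \<in> space P" for g
    unfolding Y_def using iff[OF that DB] by (simp add: space_PiM)
  have "(\<lambda>g. (restrict g A, restrict g B)) -` (X \<times> Y) \<inter> space P
      = {g \<in> space P. \<forall>w\<in>insert z T. g \<in> degenerate \<delta> w}" using X Y by auto
  moreover have "(\<lambda>g. restrict g A) -` X \<inter> space P = degenerate \<delta> z"
    using X by (auto simp: degenerate_def space_P)
  moreover have "(\<lambda>g. restrict g B) -` Y \<inter> space P = {g \<in> space P. \<forall>w\<in>T. g \<in> degenerate \<delta> w}"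
    using Y by auto
  ultimately show ?case
    using prod insert prob_degenerate_translate[OF inv, of \<delta> z] by (simp add: pairwise_insert)
qed

section \<open>Counting lattice paths with many degenerate balls\<close>

lemma linear_lower_bound_with_probability_half:
  assumes inv: "translation_invariant P" and fin: "finite_range_dependence P"
  shows "\<exists>c>0. \<exists>\<rho>>0. \<forall>m\<ge>1. \<forall>y. norm y = real m * \<rho> \<longrightarrow>
    (\<exists>E\<in>events. prob E \<le> 1 / 2 \<and> (\<forall>g\<in>space P - E. c * norm y \<le> riem_dist g 0 y))"
proof -
  obtain R where R: "R > 0" and indep: "\<And>A B. (\<forall>x\<in>A. \<forall>y\<in>B. R \<le> norm (x - y)) \<Longrightarrow>
      indep_var (\<Pi>\<^sub>M x\<in>A. borel) (\<lambda>g. restrict g A) (\<Pi>\<^sub>M y\<in>B. borel) (\<lambda>g. restrict g B)"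
    using fin unfolding finite_range_dependence_def by blast
  define d where "d = real CARD('n)"
  \<comment> \<open>Centres at least \<open>\<rho>\<close> apart are at least \<open>\<rho> - 2d\<close> apart after rounding, so balls of radius \<open>d + 1\<close>
    around the rounded centres are at distance at least \<open>R\<close>.\<close>
  define \<rho> where "\<rho> = R + 4 * d + 2"
  have d: "0 < d" by (simp add: d_def)
  have \<rho>: "1 \<le> \<rho>" using R d by (simp add: \<rho>_def)
  define S where "S = (lattice_steps (\<rho> + 2 * d) :: (real^'n) set)"
  define K where "K = card S"
  have "0 \<in> S" using \<rho> d by (simp add: S_def lattice_steps_def)
  moreover have "finite S" unfolding S_def by (rule finite_lattice_steps)
  ultimately have K: "0 < K" unfolding K_def by (auto simp: card_gt_0_iff)
  \<comment> \<open>This bound on the probability turns the union bound \<open>(4 K\<^sup>2 p)\<^sup>m\<close> below into at most \<open>(1/2)\<^sup>m\<close>.\<close>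
  have "\<forall>\<^sub>F k in sequentially. prob (degenerate (1 / real (Suc k)) 0) < 1 / (8 * real K ^ 2)"
    using K by (intro order_tendstoD(2)[OF prob_degenerate_tendsto_0]) simp
  then obtain k where k: "prob (degenerate (1 / real (Suc k)) 0) < 1 / (8 * real K ^ 2)"
    by (auto simp: eventually_sequentially)
  define \<delta> where "\<delta> = 1 / real (Suc k)"
  have \<delta>: "0 < \<delta>" by (simp add: \<delta>_def)
  define p where "p = prob (degenerate \<delta> 0)"
  have p: "0 \<le> p" "4 * real K ^ 2 * p \<le> 1 / 2"
    using k K unfolding p_def \<delta>_def by (simp_all add: field_simps)
  have main: "\<exists>E\<in>events. prob E \<le> 1 / 2 \<and> (\<forall>g\<in>space P - E. \<delta> * real m \<le> riem_dist g 0 y)"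
    if m: "m \<ge> 1" and y: "norm y = real (2 * m) * \<rho>" for m and y :: "real^'n"
  proof -
    define paths where "paths = {zs. length zs = 2 * m \<and> successively (\<lambda>z w. w - z \<in> S) (0 # zs)}"
    have paths: "finite paths" "card paths \<le> K ^ (2 * m)"
      using card_paths[OF \<open>finite S\<close>] unfolding paths_def K_def by blast+
    define J where "J = (\<Union>zs\<in>paths. {T. T \<subseteq> set zs \<and> card T = m
        \<and> pairwise (\<lambda>z w. R + 2 * (real CARD('n) + 1) \<le> dist z w) T})"
    define E where "E = (\<Union>T\<in>J. {g \<in> space P. \<forall>z\<in>T. g \<in> degenerate \<delta> z})"
    have finT: "finite T" "card T = m" if "T \<in> J" for T
      using that by (auto simp: J_def intro: finite_subset)
    \<comment> \<open>Union bound: at most \<open>K\<^sup>2\<^sup>m\<close> paths, and at most \<open>2\<^sup>2\<^sup>m\<close> sets \<open>T\<close> on each of them.\<close>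
    have "finite J" unfolding J_def using paths(1) by (intro finite_UN_I) auto
    have "card J \<le> (\<Sum>zs\<in>paths. card {T. T \<subseteq> set zs \<and> card T = m
        \<and> pairwise (\<lambda>z w. R + 2 * (real CARD('n) + 1) \<le> dist z w) T})"
      unfolding J_def by (rule card_UN_le[OF paths(1)])
    also have "\<dots> \<le> (\<Sum>zs\<in>paths. 4 ^ m)"
    proof (rule sum_mono)
      fix zs assume zs: "zs \<in> paths"
      have "card {T. T \<subseteq> set zs \<and> card T = m
        \<and> pairwise (\<lambda>z w. R + 2 * (real CARD('n) + 1) \<le> dist z w) T} \<le> card (Pow (set zs))"
        by (intro card_mono) auto
      also have "\<dots> = 2 ^ card (set zs)" by (simp add: card_Pow)
      also have "\<dots> \<le> 2 ^ (2 * m)"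
        using zs card_length[of zs] by (intro power_increasing) (auto simp: paths_def)
      finally show "card {T. T \<subseteq> set zs \<and> card T = m
        \<and> pairwise (\<lambda>z w. R + 2 * (real CARD('n) + 1) \<le> dist z w) T} \<le> 4 ^ m"
        by (simp add: power_mult)
    qed
    also have "\<dots> \<le> K ^ (2 * m) * 4 ^ m" using paths(2) by simp
    also have "\<dots> = (4 * K ^ 2) ^ m" by (simp add: power_mult power_mult_distrib)
    finally have "real (card J) \<le> real ((4 * K ^ 2) ^ m)" by (rule of_nat_mono)
    then have cJ: "real (card J) \<le> (4 * real K ^ 2) ^ m" by simp
    have ET: "{g \<in> space P. \<forall>z\<in>T. g \<in> degenerate \<delta> z} \<in> events" if "T \<in> J" for T
      using finT[OF that] sets_degenerate
      by (intro sets.sets_Collect_countable_All' countable_finite)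
         (simp_all add: Int_def[symmetric] Collect_conj_eq)
    have "prob E \<le> (\<Sum>T\<in>J. prob {g \<in> space P. \<forall>z\<in>T. g \<in> degenerate \<delta> z})"
      unfolding E_def using ET \<open>finite J\<close> by (intro measure_UNION_le) auto
    also have "\<dots> = (\<Sum>T\<in>J. p ^ m)"
    proof (rule sum.cong[OF refl])
      fix T assume T: "T \<in> J"
      then have "pairwise (\<lambda>z w. R + 2 * (real CARD('n) + 1) \<le> dist z w) T" by (auto simp: J_def)
      from prob_all_degenerate[OF inv indep finT(1)[OF T] this]
      show "prob {g \<in> space P. \<forall>z\<in>T. g \<in> degenerate \<delta> z} = p ^ m"
        using finT(2)[OF T] by (simp add: p_def)
    qed
    also have "\<dots> \<le> (4 * real K ^ 2) ^ m * p ^ m"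
      using cJ p by (simp add: mult_right_mono)
    also have "\<dots> = (4 * real K ^ 2 * p) ^ m" by (simp add: power_mult_distrib)
    also have "\<dots> \<le> (1 / 2) ^ m" using p by (intro power_mono) auto
    also have "\<dots> \<le> (1 / 2) ^ 1" using m by (intro power_decreasing) auto
    finally have "prob E \<le> 1 / 2" by simp
    moreover have "E \<in> events" unfolding E_def using ET \<open>finite J\<close> by (intro sets.finite_UN) auto
    moreover have "\<delta> * real m \<le> riem_dist g 0 y" if g: "g \<in> space P - E" for g
    proof (rule riem_dist_geI)
      fix a b \<gamma> assume \<gamma>: "C1_curve a b \<gamma>" "\<gamma> a = 0" "\<gamma> b = y"
      have gm: "g \<in> metrics" using g by (simp add: space_P)
      obtain zs where zs: "length zs = 2 * m"
        "successively (\<lambda>z w. w - z \<in> S) (0 # zs)"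
        "sorted_wrt (\<lambda>z w. R + 2 * (real CARD('n) + 1) \<le> dist z w) zs"
        "\<delta> * real (length (filter (\<lambda>z. g \<notin> degenerate \<delta> z) zs)) \<le> riem_length g a b \<gamma>"
        using many_elliptic_balls_along_curve[OF gm \<gamma>(1,2) \<rho>, of \<delta> "2 * m"] \<delta> y \<gamma>(3)
        unfolding S_def d_def \<rho>_def by (auto simp: algebra_simps)
      have "m \<le> length (filter (\<lambda>z. g \<notin> degenerate \<delta> z) zs)"
      proof (rule ccontr)
        assume "\<not> ?thesis"
        then have many: "m \<le> length (filter (\<lambda>z. g \<in> degenerate \<delta> z) zs)"
          using sum_length_filter_compl[of "\<lambda>z. g \<in> degenerate \<delta> z" zs] zs(1) by simp
        \<comment> \<open>Separation makes the entries distinct, so that \<open>m\<close> positions give \<open>m\<close> different balls.\<close>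
        have "distinct zs" using zs(3) R by (induction zs) auto
        then have "m \<le> card (set (filter (\<lambda>z. g \<in> degenerate \<delta> z) zs))"
          using many by (simp only: distinct_card[OF distinct_filter])
        then obtain T where T: "T \<subseteq> set (filter (\<lambda>z. g \<in> degenerate \<delta> z) zs)" "card T = m"
          using obtain_subset_with_card_n by blast
        have "pairwise (\<lambda>z w. R + 2 * (real CARD('n) + 1) \<le> dist z w) (set zs)"
          using zs(3) by (induction zs) (auto simp: pairwise_insert dist_commute)
        then have "pairwise (\<lambda>z w. R + 2 * (real CARD('n) + 1) \<le> dist z w) T"
          by (rule pairwise_subset) (use T in auto)
        then have "T \<in> J" using T zs(1,2) by (auto simp: J_def paths_def)
        with T g show False by (auto simp: E_def)
      qed
      then have "\<delta> * real m \<le> \<delta> * real (length (filter (\<lambda>z. g \<notin> degenerate \<delta> z) zs))"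
        using \<delta> by simp
      with zs(4) show "\<delta> * real m \<le> riem_length g a b \<gamma>" by linarith
    qed
    ultimately show ?thesis by blast
  qed
  have "\<forall>m\<ge>1. \<forall>y. norm y = real m * (2 * \<rho>) \<longrightarrow> (\<exists>E\<in>events. prob E \<le> 1 / 2 \<and>
        (\<forall>g\<in>space P - E. \<delta> / (2 * \<rho>) * norm y \<le> riem_dist g 0 y))"
  proof (intro allI impI)
    fix m :: nat and y :: "real^'n" assume *: "m \<ge> 1" "norm y = real m * (2 * \<rho>)"
    have "\<delta> / (2 * \<rho>) * norm y = \<delta> * real m" using * \<rho> by simp
    with main[of m y] * show "\<exists>E\<in>events. prob E \<le> 1 / 2 \<and>
        (\<forall>g\<in>space P - E. \<delta> / (2 * \<rho>) * norm y \<le> riem_dist g 0 y)" by simp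
  qed
  moreover have "0 < \<delta> / (2 * \<rho>)" "0 < 2 * \<rho>" using \<delta> \<rho> by auto
  ultimately show ?thesis by blast
qed

end

theorem theorem2p5:
  fixes P :: "(real^'n \<Rightarrow> real^'n^'n) measure"
    and \<mu> :: "real^'n \<Rightarrow> real"
  assumes "CARD('n) \<ge> 2"
    and "prob_space P"
    and "sets P = sets cylinder_algebra"
    and "translation_invariant P"
    and "finite_range_dependence P"
    and "exponential_moments P"
    and "\<forall>v\<in>sphere 0 1. time_constant P v (\<mu> v)"
  shows "\<forall>v\<in>sphere 0 1. \<mu> v > 0"
proof
  interpret prob_space P by fact
  interpret random_metric P by unfold_locales fact
  fix v :: "real^'n" assume v: "v \<in> sphere 0 1"
  let ?F = "\<lambda>t. \<integral>g. \<bar>riem_dist g 0 (t *\<^sub>R v) / t - \<mu> v\<bar> \<partial>P"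
  have tc: "0 \<le> \<mu> v" "\<And>t. t > 0 \<Longrightarrow> integrable P (\<lambda>g. riem_dist g 0 (t *\<^sub>R v) / t)"
    "(?F \<longlongrightarrow> 0) at_top"
    using assms(7) v by (auto simp: time_constant_def)
  obtain c \<rho> where c: "c > 0" "\<rho> > 0" and low: "\<And>m y. m \<ge> 1 \<Longrightarrow> norm y = real m * \<rho> \<Longrightarrow>
      \<exists>E\<in>events. prob E \<le> 1 / 2 \<and> (\<forall>g\<in>space P - E. c * norm y \<le> riem_dist g 0 y)"
    using linear_lower_bound_with_probability_half[OF assms(4,5)] by blast
  show "\<mu> v > 0"
  proof (rule ccontr)
    assume "\<not> \<mu> v > 0"
    with tc(1) have \<mu>0: "\<mu> v = 0" by simp
    have "\<forall>\<^sub>F t in at_top. ?F t < c / 2"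
      using c by (intro order_tendstoD(2)[OF tc(3)]) simp
    then obtain t0 where t0: "\<And>t. t \<ge> t0 \<Longrightarrow> ?F t < c / 2"
      by (auto simp: eventually_at_top_linorder)
    obtain m where m: "t0 / \<rho> < real m" using reals_Archimedean2 by blast
    define t where "t = real (Suc m) * \<rho>"
    have t: "t > 0" using c by (simp add: t_def)
    have "t0 < real m * \<rho>" using m c by (simp add: field_simps)
    then have "t \<ge> t0" using c by (simp add: t_def algebra_simps)
    have nt: "norm (t *\<^sub>R v) = real (Suc m) * \<rho>" using v c by (simp add: t_def)
    obtain E where E: "E \<in> events" "prob E \<le> 1 / 2"
      "\<And>g. g \<in> space P - E \<Longrightarrow> c * norm (t *\<^sub>R v) \<le> riem_dist g 0 (t *\<^sub>R v)"
      using low[OF _ nt] by auto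
    have "c / 2 \<le> c * prob (space P - E)"
      using E c by (simp add: prob_compl)
    also have "\<dots> = (\<integral>g. c * indicator (space P - E) g \<partial>P)"
      using E(1) by simp
    also have "\<dots> \<le> ?F t"
    proof (rule integral_mono)
      show "integrable P (\<lambda>g. c * indicator (space P - E) g)"
        using E(1) by (intro integrable_mult_right integrable_real_indicator)
          (auto simp: emeasure_eq_measure)
      show "integrable P (\<lambda>g. \<bar>riem_dist g 0 (t *\<^sub>R v) / t - \<mu> v\<bar>)"
        using integrable_abs[OF tc(2)[OF t]] unfolding \<mu>0 diff_0_right .
      fix g assume "g \<in> space P"
      show "c * indicator (space P - E) g \<le> \<bar>riem_dist g 0 (t *\<^sub>R v) / t - \<mu> v\<bar>"
      proof (cases "g \<in> E")
        case False
        have "c * t \<le> riem_dist g 0 (t *\<^sub>R v)"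
          using E(3)[of g] False \<open>g \<in> space P\<close> v t by simp
        then have "c \<le> riem_dist g 0 (t *\<^sub>R v) / t" using t by (simp add: field_simps)
        also have "\<dots> \<le> \<bar>riem_dist g 0 (t *\<^sub>R v) / t\<bar>" by (rule abs_ge_self)
        finally show ?thesis using False \<open>g \<in> space P\<close> by (simp add: \<mu>0)
      qed simp
    qed
    finally show False using t0[OF \<open>t \<ge> t0\<close>] by simp
  qed
qed

end
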